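(* Let $P_1,P_2$ be processes each satisfying \texttt{price-time priority}, \texttt{positive bid-ask spread} and \texttt{conservation}. Let $(B,A)$ be an order-domain and $(\Delta,\omega)$ an instruction such that $((B,A),(\Delta,\omega))$ is a legal-input, and let $P_i(B,A,(\Delta,\omega))=(\hat B_i,\hat A_i,M_i)$ for $i=1,2$. Then $(\hat B_1,\hat A_1,\mathcal C(M_1))=(\hat B_2,\hat A_2,\mathcal C(M_2))$. Moreover, for each $i\in\{1,2\}$: (1) $(\hat B_i,\hat A_i)$ is not matchable; (2) the timestamps of the orders in $\hat B_i\cup\hat A_i$ are pairwise distinct and form a subset of the set of timestamps of orders in $B\cup A\cup\{\omega\}$; (3) the ids of the orders in $\hat B_i\cup\hat A_i$ are pairwise distinct and form a subset of $\mathsf{ids}(B\cup A)\cup\{\mathsf{id}(\omega)\}$; (4) if $\Delta=\mathsf{Del}$ then $\mathsf{id}(\omega)\notin\mathsf{ids}(\hat B_i\cup\hat A_i)$.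
   Context: An order is a 4-tuple $\omega=(\mathsf{id}(\omega),\mathsf{timestamp}(\omega),\mathsf{qty}(\omega),\mathsf{price}(\omega))$ of natural numbers with $\mathsf{qty}(\omega)>0$; $\mathsf{ids}(S)$ is the set of ids of orders in $S$. An order-domain is a pair $(B,A)$ of finite sets of orders ($B$ = bids, $A$ = asks); it is admissible if all orders in $B\cup A$ have pairwise distinct ids and pairwise distinct timestamps. A bid $b$ and ask $a$ are tradable if $\mathsf{price}(b)\ge\mathsf{price}(a)$; $(B,A)$ is matchable if some $b\in B$, $a\in A$ are tradable. Competitiveness: bid $b_1\succ b_2$ iff $\mathsf{price}(b_1)>\mathsf{price}(b_2)$, or prices equal and $\mathsf{timestamp}(b_1)<\mathsf{timestamp}(b_2)$; ask $a_1\succ a_2$ iff $\mathsf{price}(a_1)<\mathsf{price}(a_2)$, or prices equal and $\mathsf{timestamp}(a_1)<\mathsf{timestamp}(a_2)$. A transaction is a triple $t=(\mathsf{id_{bid}}(t),\mathsf{id_{ask}}(t),\mathsf{qty}(t))$ of natural numbers with $\mathsf{qty}(t)>0$. It is valid w.r.t. $(B,A)$ if there are $b\in B$, $a\in A$ with $\mathsf{id_{bid}}(t)=\mathsf{id}(b)$, $\mathsf{id_{ask}}(t)=\mathsf{id}(a)$, $b,a$ tradable, and $\mathsf{qty}(t)\le\min(\mathsf{qty}(b),\mathsf{qty}(a))$. For a finite set of transactions $T$, $\mathsf{Qty}(T,id)$ is the sum of quantities of transactions in $T$ whose bid id (for a bid) resp. ask id (for an ask) equals $id$; $\mathsf{ids_{bid}}(T),\mathsf{ids_{ask}}(T)$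 are the sets of bid/ask ids occurring in $T$. A matching over an admissible $(B,A)$ is a set $M$ of transactions valid w.r.t. $(B,A)$ with $\mathsf{Qty}(M,\mathsf{id}(\omega))\le\mathsf{qty}(\omega)$ for all $\omega\in B\cup A$. The canonical form $\mathcal C(M)$ is the set of transactions containing, for each bid id/ask id pair with positive total quantity in $M$, exactly one transaction between them whose quantity equals that total (and no other transactions). $\mathsf{Bids}(M,B)$ is the set of bids of $B$ occurring in $M$ with quantity replaced by $\mathsf{Qty}(M,\mathsf{id}(b))$; $\mathsf{Asks}(M,A)$ likewise. Sets of orders are viewed as multisets where each order (quantity field suppressed) has multiplicity equal to its quantity; $S_1-S_2$ is multiset difference. An instruction is a pair $(\Delta,\omega)$ with command $\Delta\in\{\mathsf{Buy},\mathsf{Sell},\mathsf{Del}\}$ and an order $\omega$. $\mathsf{Absorb}(B,A,(\mathsf{Del},\omega))=(\{b\in B:\mathsf{id}(b)\ne\mathsf{id}(\omega)\},\{a\in A:\mathsf{id}(a)\ne\mathsf{id}(\omega)\})$, $\mathsf{Absorb}(B,A,(\mathsf{Buy},\beta))=(B\cup\{\beta\},A)$, $\mathsf{Absorb}(B,A,(\mathsf{Sell},\alpha))=(B,A\cup\{\alpha\})$. $((B,A),\tau)$ is a legal-input if $(B,A)$ is not matchable and $\mathsf{Absorb}(B,A,\tau)$ is admissible. A process is a function $P:(B,A,\tau)\mapsto(\hat B,\hat A,M)$ (two sets of orders and an instruction to two sets of orders and a set of transactions). For every legal-input $((B,A),\tau)$ with $P(B,A,\tau)=(\hat B,\hat A,M)$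 and $(B',A')=\mathsf{Absorb}(B,A,\tau)$, $P$ satisfies: \texttt{positive bid-ask spread} if $(\hat B,\hat A)$ is not matchable; \texttt{price-time priority} if for all $a,a'\in A'$ with $a\succ a'$ and $\mathsf{id}(a')\in\mathsf{ids_{ask}}(M)$ we have $\mathsf{Qty}(M,\mathsf{id}(a))=\mathsf{qty}(a)$, and for all $b,b'\in B'$ with $b\succ b'$ and $\mathsf{id}(b')\in\mathsf{ids_{bid}}(M)$ we have $\mathsf{Qty}(M,\mathsf{id}(b))=\mathsf{qty}(b)$; \texttt{conservation} if $M$ is a matching over $(B',A')$, $\hat B=B'-\mathsf{Bids}(M,B')$ and $\hat A=A'-\mathsf{Asks}(M,A')$. A process satisfies a property if it does so for all legal-inputs. *)

theory Defs
  imports Main "HOL-Library.Multiset"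
begin

typedef auction_order = "{(i :: nat, t :: nat, q :: nat, p :: nat). q > 0}"
  by (rule exI[of _ "(0, 0, 1, 0)"]) simp

definition ident :: "auction_order \<Rightarrow> nat" where
  "ident \<omega> = (case Rep_auction_order \<omega> of (i, t, q, p) \<Rightarrow> i)"

definition timestamp :: "auction_order \<Rightarrow> nat" where
  "timestamp \<omega> = (case Rep_auction_order \<omega> of (i, t, q, p) \<Rightarrow> t)"

definition qty :: "auction_order \<Rightarrow> nat" where
  "qty \<omega> = (case Rep_auction_order \<omega> of (i, t, q, p) \<Rightarrow> q)"

definition price :: "auction_order \<Rightarrow> nat" where
  "price \<omega> = (case Rep_auction_order \<omega> of (i, t, q, p) \<Rightarrow> p)"

definition ids :: "auction_order set \<Rightarrow> nat set" where
  "ids S = ident ` S"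

typedef transaction = "{(i :: nat, j :: nat, q :: nat). q > 0}"
  by (rule exI[of _ "(0, 0, 1)"]) simp

definition id_bid :: "transaction \<Rightarrow> nat" where
  "id_bid t = (case Rep_transaction t of (i, j, q) \<Rightarrow> i)"

definition id_ask :: "transaction \<Rightarrow> nat" where
  "id_ask t = (case Rep_transaction t of (i, j, q) \<Rightarrow> j)"

definition tqty :: "transaction \<Rightarrow> nat" where
  "tqty t = (case Rep_transaction t of (i, j, q) \<Rightarrow> q)"

text \<open>Throughout, the first set of an order-domain holds the bids, the second the asks.\<close>

definition order_domain :: "auction_order set \<Rightarrow> auction_order set \<Rightarrow> bool" where
  "order_domain B A \<longleftrightarrow> finite B \<and> finite A"

definition admissible :: "auction_order set \<Rightarrow> auction_order set \<Rightarrow> bool" where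
  "admissible B A \<longleftrightarrow> order_domain B A \<and> inj_on ident (B \<union> A) \<and> inj_on timestamp (B \<union> A)"

definition tradable :: "auction_order \<Rightarrow> auction_order \<Rightarrow> bool" where
  "tradable b a \<longleftrightarrow> price b \<ge> price a"

definition matchable :: "auction_order set \<Rightarrow> auction_order set \<Rightarrow> bool" where
  "matchable B A \<longleftrightarrow> (\<exists>b\<in>B. \<exists>a\<in>A. tradable b a)"

definition bid_beats :: "auction_order \<Rightarrow> auction_order \<Rightarrow> bool" where
  "bid_beats b1 b2 \<longleftrightarrow>
     price b1 > price b2 \<or> price b1 = price b2 \<and> timestamp b1 < timestamp b2"

definition ask_beats :: "auction_order \<Rightarrow> auction_order \<Rightarrow> bool" where
  "ask_beats a1 a2 \<longleftrightarrow>
     price a1 < price a2 \<or> price a1 = price a2 \<and> timestamp a1 < timestamp a2"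

definition valid_transaction ::
    "transaction \<Rightarrow> auction_order set \<Rightarrow> auction_order set \<Rightarrow> bool" where
  "valid_transaction t B A \<longleftrightarrow>
     (\<exists>b\<in>B. \<exists>a\<in>A. id_bid t = ident b \<and> id_ask t = ident a \<and> tradable b a \<and>
        tqty t \<le> min (qty b) (qty a))"

definition Qty_bid :: "transaction set \<Rightarrow> nat \<Rightarrow> nat" where
  "Qty_bid T i = (\<Sum>t | t \<in> T \<and> id_bid t = i. tqty t)"

definition Qty_ask :: "transaction set \<Rightarrow> nat \<Rightarrow> nat" where
  "Qty_ask T i = (\<Sum>t | t \<in> T \<and> id_ask t = i. tqty t)"

definition ids_bid :: "transaction set \<Rightarrow> nat set" where
  "ids_bid T = id_bid ` T"

definition ids_ask :: "transaction set \<Rightarrow> nat set" where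
  "ids_ask T = id_ask ` T"

definition matching ::
    "transaction set \<Rightarrow> auction_order set \<Rightarrow> auction_order set \<Rightarrow> bool" where
  "matching M B A \<longleftrightarrow>
     admissible B A \<and> finite M \<and> (\<forall>t\<in>M. valid_transaction t B A) \<and>
     (\<forall>b\<in>B. Qty_bid M (ident b) \<le> qty b) \<and> (\<forall>a\<in>A. Qty_ask M (ident a) \<le> qty a)"

definition Qty_pair :: "transaction set \<Rightarrow> nat \<Rightarrow> nat \<Rightarrow> nat" where
  "Qty_pair T i j = (\<Sum>t | t \<in> T \<and> id_bid t = i \<and> id_ask t = j. tqty t)"

text \<open>Transactions have positive quantity by type, so a pair of ids with total quantity 0
  contributes nothing here, and any other pair contributes exactly one transaction.\<close>

definition canonical :: "transaction set \<Rightarrow> transaction set" where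
  "canonical M = {t. tqty t = Qty_pair M (id_bid t) (id_ask t)}"

definition Bids :: "transaction set \<Rightarrow> auction_order set \<Rightarrow> auction_order set" where
  "Bids M B = {\<omega>. \<exists>b\<in>B. ident b \<in> ids_bid M \<and> ident \<omega> = ident b \<and>
     timestamp \<omega> = timestamp b \<and> qty \<omega> = Qty_bid M (ident b) \<and> price \<omega> = price b}"

definition Asks :: "transaction set \<Rightarrow> auction_order set \<Rightarrow> auction_order set" where
  "Asks M A = {\<omega>. \<exists>a\<in>A. ident a \<in> ids_ask M \<and> ident \<omega> = ident a \<and>
     timestamp \<omega> = timestamp a \<and> qty \<omega> = Qty_ask M (ident a) \<and> price \<omega> = price a}"

text \<open>The multiset view of a finite set of orders: an order without its quantity field has
  its quantity as multiplicity. A multiset is read back as the set having exactly one order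
  per element, with quantity the multiplicity (which is positive by type).\<close>

definition order_mset :: "auction_order set \<Rightarrow> (nat \<times> nat \<times> nat) multiset" where
  "order_mset S = (\<Sum>\<omega>\<in>S. replicate_mset (qty \<omega>) (ident \<omega>, timestamp \<omega>, price \<omega>))"

definition orders_of_mset :: "(nat \<times> nat \<times> nat) multiset \<Rightarrow> auction_order set" where
  "orders_of_mset X = {\<omega>. qty \<omega> = count X (ident \<omega>, timestamp \<omega>, price \<omega>)}"

definition order_diff :: "auction_order set \<Rightarrow> auction_order set \<Rightarrow> auction_order set" where
  "order_diff S1 S2 = orders_of_mset (order_mset S1 - order_mset S2)"

datatype command = Buy | Sell | Del

type_synonym instruction = "command \<times> auction_order"

fun absorb :: "auction_order set \<Rightarrow> auction_order set \<Rightarrow> instruction \<Rightarrow>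
    auction_order set \<times> auction_order set" where
  "absorb B A (Del, \<omega>) = ({b \<in> B. ident b \<noteq> ident \<omega>}, {a \<in> A. ident a \<noteq> ident \<omega>})"
| "absorb B A (Buy, \<beta>) = (B \<union> {\<beta>}, A)"
| "absorb B A (Sell, \<alpha>) = (B, A \<union> {\<alpha>})"

definition legal_input :: "auction_order set \<Rightarrow> auction_order set \<Rightarrow> instruction \<Rightarrow> bool" where
  "legal_input B A \<tau> \<longleftrightarrow>
     order_domain B A \<and> \<not> matchable B A \<and>
     (case absorb B A \<tau> of (B', A') \<Rightarrow> admissible B' A')"

type_synonym process = "auction_order set \<Rightarrow> auction_order set \<Rightarrow> instruction \<Rightarrow>
  auction_order set \<times> auction_order set \<times> transaction set"

definition positive_bid_ask_spread :: "process \<Rightarrow> bool" where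
  "positive_bid_ask_spread P \<longleftrightarrow>
     (\<forall>B A \<tau> Bh Ah M. legal_input B A \<tau> \<longrightarrow> P B A \<tau> = (Bh, Ah, M) \<longrightarrow> \<not> matchable Bh Ah)"

definition price_time_priority :: "process \<Rightarrow> bool" where
  "price_time_priority P \<longleftrightarrow>
     (\<forall>B A \<tau> Bh Ah M B' A'.
        legal_input B A \<tau> \<longrightarrow> P B A \<tau> = (Bh, Ah, M) \<longrightarrow> absorb B A \<tau> = (B', A') \<longrightarrow>
        (\<forall>a\<in>A'. \<forall>a'\<in>A'. ask_beats a a' \<and> ident a' \<in> ids_ask M \<longrightarrow>
           Qty_ask M (ident a) = qty a) \<and>
        (\<forall>b\<in>B'. \<forall>b'\<in>B'. bid_beats b b' \<and> ident b' \<in> ids_bid M \<longrightarrow>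
           Qty_bid M (ident b) = qty b))"

definition conservation :: "process \<Rightarrow> bool" where
  "conservation P \<longleftrightarrow>
     (\<forall>B A \<tau> Bh Ah M B' A'.
        legal_input B A \<tau> \<longrightarrow> P B A \<tau> = (Bh, Ah, M) \<longrightarrow> absorb B A \<tau> = (B', A') \<longrightarrow>
        matching M B' A' \<and>
        Bh = order_diff B' (Bids M B') \<and> Ah = order_diff A' (Asks M A'))"

end

theory Submission imports Defs begin

text \<open>Since \<open>(B, A)\<close> is not matchable, every transaction involves the incoming order \<open>\<omega>\<close>, so a
  matching is determined, up to canonical form, by the quantities allocated to the orders on the
  other side. If two outcomes allocate \<open>q\<^sub>1 a < q\<^sub>2 a\<close> to some \<open>a\<close>, then in the first one \<open>a\<close> is not
  exhausted, so \<open>\<omega>\<close> must be exhausted by the positive spread; comparing totals gives some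
  \<open>a'\<close> with \<open>q\<^sub>2 a' < q\<^sub>1 a'\<close>. Whichever of \<open>a\<close>, \<open>a'\<close> is more competitive, priority is violated in
  one of the outcomes.\<close>

section \<open>Orders and their quantities\<close>

lemma auction_order_eqI:
  assumes "ident x = ident y" "timestamp x = timestamp y" "qty x = qty y" "price x = price y"
  shows "x = y"
  using assms unfolding ident_def timestamp_def qty_def price_def
  by (intro Rep_auction_order_inject[THEN iffD1]) (auto split: prod.splits)

lemma auction_order_exists:
  assumes "0 < q"
  obtains x where "ident x = i" "timestamp x = t" "qty x = q" "price x = p"
proof -
  have "Rep_auction_order (Abs_auction_order (i, t, q, p)) = (i, t, q, p)"
    using assms by (simp add: Abs_auction_order_inverse)
  then show thesis
    by (intro that[of "Abs_auction_order (i, t, q, p)"])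
      (simp_all add: ident_def timestamp_def qty_def price_def)
qed

lemma qty_pos: "0 < qty x"
  using Rep_auction_order[of x] by (auto simp: qty_def)

lemma tqty_pos: "0 < tqty t"
  using Rep_transaction[of t] by (auto simp: tqty_def)

text \<open>Orders have positive quantity, so an \<open>x \<in> S\<close> with \<open>g x = 0\<close> contributes nothing.\<close>

definition requantify :: "(auction_order \<Rightarrow> nat) \<Rightarrow> auction_order set \<Rightarrow> auction_order set" where
  "requantify g S = {y. \<exists>x\<in>S. ident y = ident x \<and> timestamp y = timestamp x \<and>
     price y = price x \<and> qty y = g x}"

lemma requantifyE:
  assumes "y \<in> requantify g S"
  obtains x where "x \<in> S" "ident y = ident x" "timestamp y = timestamp x" "price y = price x"
    "qty y = g x" "0 < g x"
  using assms qty_pos[of y] unfolding requantify_def by auto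

lemma requantify_exists:
  assumes "x \<in> S" "0 < g x"
  obtains y where "y \<in> requantify g S" "price y = price x"
proof -
  obtain y where "ident y = ident x" "timestamp y = timestamp x" "qty y = g x" "price y = price x"
    using auction_order_exists[OF assms(2)] by metis
  then show thesis
    using that[of y] assms(1) unfolding requantify_def by auto
qed

lemma requantify_qty: "requantify qty S = S"
  unfolding requantify_def using auction_order_eqI by blast

lemma inj_on_ident_requantify:
  assumes "inj_on ident S"
  shows "inj_on ident (requantify g S)"
proof (rule inj_onI)
  fix x y
  assume xy: "x \<in> requantify g S" "y \<in> requantify g S" "ident x = ident y"
  obtain x' where x': "x' \<in> S" "ident x = ident x'" "timestamp x = timestamp x'"
      "price x = price x'" "qty x = g x'"
    using xy(1) by (rule requantifyE)
  obtain y' where y': "y' \<in> S" "ident y = ident y'" "timestamp y = timestamp y'"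
      "price y = price y'" "qty y = g y'"
    using xy(2) by (rule requantifyE)
  have "x' = y'"
    using inj_onD[OF assms _ x'(1) y'(1)] x'(2) y'(2) xy(3) by simp
  then show "x = y"
    using x' y' by (intro auction_order_eqI) simp_all
qed

lemma finite_requantify:
  assumes "finite S" "inj_on ident S"
  shows "finite (requantify g S)"
proof -
  have "ident ` requantify g S \<subseteq> ident ` S"
    by (auto elim!: requantifyE)
  then show ?thesis
    using assms by (meson finite_imageI finite_imageD finite_subset inj_on_ident_requantify)
qed

lemma count_order_mset:
  assumes "finite S"
  shows "count (order_mset S) k = (\<Sum>x\<in>S. if (ident x, timestamp x, price x) = k then qty x else 0)"
  using assms unfolding order_mset_def by (auto simp: count_sum intro!: sum.cong)

text \<open>Injectivity of \<open>ident\<close> leaves at most one order with the key of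
  \<open>x\<close>, so the sum of counts has at most one nonzero term. If \<open>g x = 0\<close>, no
  such order exists and the count is 0 as well.\<close>

lemma count_order_mset_requantify:
  assumes "finite S" "inj_on ident S" "x \<in> S"
  shows "count (order_mset (requantify g S)) (ident x, timestamp x, price x) = g x"
proof -
  let ?R = "requantify g S" and ?k = "(ident x, timestamp x, price x)"
  note count = count_order_mset[OF finite_requantify[OF assms(1,2)], of g]
  show ?thesis
  proof (cases "0 < g x")
    case True
    obtain y where y: "ident y = ident x" "timestamp y = timestamp x" "qty y = g x"
        "price y = price x"
      using auction_order_exists[OF True] by metis
    then have "y \<in> ?R"
      using assms(3) unfolding requantify_def by auto
    have "(ident z, timestamp z, price z) = ?k \<longleftrightarrow> z = y" if "z \<in> ?R" for z
      using inj_onD[OF inj_on_ident_requantify[OF assms(2)] _ that \<open>y \<in> ?R\<close>] y by auto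
    then have "count (order_mset ?R) ?k = (\<Sum>z\<in>?R. if z = y then qty z else 0)"
      unfolding count by (intro sum.cong) auto
    then show ?thesis
      using \<open>y \<in> ?R\<close> y finite_requantify[OF assms(1,2), of g] by simp
  next
    case False
    have "ident z \<noteq> ident x" if "z \<in> ?R" for z
      using that False assms(2,3) by (elim requantifyE) (metis inj_onD)
    then show ?thesis
      using False unfolding count by (auto intro!: sum.neutral)
  qed
qed

lemma count_order_mset_eq_0:
  assumes "finite S" "\<And>x. x \<in> S \<Longrightarrow> (ident x, timestamp x, price x) \<noteq> k"
  shows "count (order_mset S) k = 0"
  using assms by (auto simp: count_order_mset)

text \<open>Multiset difference and subtraction on \<open>nat\<close> both truncate at 0, so the two
  sides agree key by key. A key whose difference is 0 gives no order on either side.\<close>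

lemma order_diff_requantify:
  assumes "finite S" "inj_on ident S"
  shows "order_diff S (requantify g S) = requantify (\<lambda>x. qty x - g x) S"
proof (rule set_eqI)
  fix y
  let ?k = "(ident y, timestamp y, price y)"
  have S: "count (order_mset S) (ident x, timestamp x, price x) = qty x" if "x \<in> S" for x
    using count_order_mset_requantify[OF assms that, of qty] by (simp add: requantify_qty)
  show "y \<in> order_diff S (requantify g S) \<longleftrightarrow> y \<in> requantify (\<lambda>x. qty x - g x) S"
  proof (cases "\<exists>x\<in>S. (ident x, timestamp x, price x) = ?k")
    case True
    then obtain x where x: "x \<in> S" "ident y = ident x" "timestamp y = timestamp x"
        "price y = price x"
      by auto
    \<comment> \<open>\<open>x\<close> is the only possible origin of \<open>y\<close>, so
      membership becomes an equation between quantities.\<close>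
    have "x' = x" if "x' \<in> S" "ident x' = ident x" for x'
      using that x(1) assms(2) by (auto dest: inj_onD)
    then have "y \<in> requantify (\<lambda>x. qty x - g x) S \<longleftrightarrow> qty y = qty x - g x"
      using x unfolding requantify_def by fastforce
    moreover have "y \<in> order_diff S (requantify g S) \<longleftrightarrow> qty y = qty x - g x"
      using x S[OF x(1)] count_order_mset_requantify[OF assms x(1), of g]
      unfolding order_diff_def orders_of_mset_def by simp
    ultimately show ?thesis by simp
  next
    case False
    then have "count (order_mset S) ?k = 0"
      using assms(1) by (intro count_order_mset_eq_0) auto
    then have "y \<notin> order_diff S (requantify g S)"
      using qty_pos[of y] unfolding order_diff_def orders_of_mset_def by simp
    moreover have "y \<notin> requantify (\<lambda>x. qty x - g x) S"
      using False by (auto elim!: requantifyE)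
    ultimately show ?thesis by simp
  qed
qed

section \<open>Outcomes\<close>

text \<open>Outside \<open>ids_bid M\<close> the total is an empty sum, and no order has quantity 0;
  so a positive total encodes occurrence in \<open>M\<close>.\<close>

lemma Bids_eq_requantify: "Bids M B = requantify (\<lambda>b. Qty_bid M (ident b)) B"
proof -
  have "ident b \<in> ids_bid M" if "qty y = Qty_bid M (ident b)" for y b
  proof (rule ccontr)
    assume "ident b \<notin> ids_bid M"
    then have "Qty_bid M (ident b) = 0"
      unfolding Qty_bid_def ids_bid_def by (intro sum.neutral) (auto simp: image_iff)
    then show False using that qty_pos[of y] by simp
  qed
  then show ?thesis unfolding Bids_def requantify_def by blast
qed

lemma Asks_eq_requantify: "Asks M A = requantify (\<lambda>a. Qty_ask M (ident a)) A"
proof -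
  have "ident a \<in> ids_ask M" if "qty y = Qty_ask M (ident a)" for y a
  proof (rule ccontr)
    assume "ident a \<notin> ids_ask M"
    then have "Qty_ask M (ident a) = 0"
      unfolding Qty_ask_def ids_ask_def by (intro sum.neutral) (auto simp: image_iff)
    then show False using that qty_pos[of y] by simp
  qed
  then show ?thesis unfolding Asks_def requantify_def by blast
qed

text \<open>All summands are positive, so the sum vanishes only over the empty set; finiteness of
  \<open>M\<close> rules out the default value 0 of an infinite sum.\<close>

lemma Qty_bid_pos_iff: "finite M \<Longrightarrow> 0 < Qty_bid M i \<longleftrightarrow> i \<in> ids_bid M"
  unfolding Qty_bid_def ids_bid_def neq0_conv[symmetric]
  by (auto simp: sum_eq_0_iff image_iff tqty_pos simp del: neq0_conv)

lemma Qty_ask_pos_iff: "finite M \<Longrightarrow> 0 < Qty_ask M i \<longleftrightarrow> i \<in> ids_ask M"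
  unfolding Qty_ask_def ids_ask_def neq0_conv[symmetric]
  by (auto simp: sum_eq_0_iff image_iff tqty_pos simp del: neq0_conv)

text \<open>Here \<open>(B, A)\<close> is the order-domain after absorption; conservation expresses the residual
  order-domain through \<open>M\<close>.\<close>

definition outcome :: "transaction set \<Rightarrow> auction_order set \<Rightarrow> auction_order set \<Rightarrow> bool" where
  "outcome M B A \<longleftrightarrow> matching M B A \<and>
     (\<forall>a\<in>A. \<forall>a'\<in>A. ask_beats a a' \<and> ident a' \<in> ids_ask M \<longrightarrow> Qty_ask M (ident a) = qty a) \<and>
     (\<forall>b\<in>B. \<forall>b'\<in>B. bid_beats b b' \<and> ident b' \<in> ids_bid M \<longrightarrow> Qty_bid M (ident b) = qty b) \<and>
     \<not> matchable (order_diff B (Bids M B)) (order_diff A (Asks M A))"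

lemma outcomeD:
  assumes "outcome M B A"
  shows "finite M" "finite B" "finite A" "inj_on ident (B \<union> A)" "inj_on timestamp (B \<union> A)"
    "inj_on ident B" "inj_on ident A"
  using assms unfolding outcome_def matching_def admissible_def order_domain_def
  by (auto intro: inj_on_subset)

lemma order_diff_Bids:
  "outcome M B A \<Longrightarrow>
    order_diff B (Bids M B) = requantify (\<lambda>b. qty b - Qty_bid M (ident b)) B"
  by (simp add: Bids_eq_requantify order_diff_requantify outcomeD)

lemma order_diff_Asks:
  "outcome M B A \<Longrightarrow>
    order_diff A (Asks M A) = requantify (\<lambda>a. qty a - Qty_ask M (ident a)) A"
  by (simp add: Asks_eq_requantify order_diff_requantify outcomeD)

text \<open>If both orders had quantity left, their residuals, at unchanged prices, would make the
  residual order-domain matchable. This is how the positive spread enters the argument.\<close>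

lemma outcome_exhausted:
  assumes "outcome M B A" "b \<in> B" "a \<in> A" "tradable b a"
  shows "Qty_bid M (ident b) = qty b \<or> Qty_ask M (ident a) = qty a"
proof (rule ccontr)
  assume neg: "\<not> ?thesis"
  have "Qty_bid M (ident b) \<le> qty b" "Qty_ask M (ident a) \<le> qty a"
    using assms unfolding outcome_def matching_def by auto
  with neg have "0 < qty b - Qty_bid M (ident b)" "0 < qty a - Qty_ask M (ident a)"
    by auto
  then obtain b' a' where "b' \<in> order_diff B (Bids M B)" "price b' = price b"
      "a' \<in> order_diff A (Asks M A)" "price a' = price a"
    unfolding order_diff_Bids[OF assms(1)] order_diff_Asks[OF assms(1)]
    using requantify_exists[OF assms(2), of "\<lambda>b. qty b - Qty_bid M (ident b)"]
      requantify_exists[OF assms(3), of "\<lambda>a. qty a - Qty_ask M (ident a)"] by metis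
  then show False
    using assms(1,4) unfolding outcome_def matchable_def tradable_def by metis
qed

section \<open>Uniqueness of the allocation\<close>

text \<open>The exchange argument, kept abstract so that it serves asks and bids alike:
  \<open>q\<^sub>1\<close> and \<open>q\<^sub>2\<close> are allocations under the capacities
  \<open>c\<close>. The assumption \<open>fill\<close> carries the effect of the spread: after a
  shortfall under \<open>q\<^sub>1\<close>, the common counterparty is used up there.\<close>

lemma priority_allocation_le:
  fixes q\<^sub>1 q\<^sub>2 c :: "'a \<Rightarrow> nat"
  assumes "finite S" "x \<in> S"
    and total: "\<And>x y. x \<in> S \<Longrightarrow> y \<in> S \<Longrightarrow> x \<noteq> y \<Longrightarrow> beats x y \<or> beats y x"
    and cap: "\<And>x. x \<in> S \<Longrightarrow> q\<^sub>1 x \<le> c x" "\<And>x. x \<in> S \<Longrightarrow> q\<^sub>2 x \<le> c x"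
    and prio: "\<And>x y. x \<in> S \<Longrightarrow> y \<in> S \<Longrightarrow> beats x y \<Longrightarrow> 0 < q\<^sub>1 y \<Longrightarrow> q\<^sub>1 x = c x"
      "\<And>x y. x \<in> S \<Longrightarrow> y \<in> S \<Longrightarrow> beats x y \<Longrightarrow> 0 < q\<^sub>2 y \<Longrightarrow> q\<^sub>2 x = c x"
    and fill: "\<And>x. x \<in> S \<Longrightarrow> q\<^sub>1 x < q\<^sub>2 x \<Longrightarrow> sum q\<^sub>2 S \<le> sum q\<^sub>1 S"
  shows "q\<^sub>2 x \<le> q\<^sub>1 x"
proof (rule ccontr)
  assume "\<not> ?thesis"
  then have lt: "q\<^sub>1 x < q\<^sub>2 x" by simp
  have "\<exists>y\<in>S. q\<^sub>2 y < q\<^sub>1 y"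
  proof (rule ccontr)
    assume "\<not> ?thesis"
    then have "sum q\<^sub>1 S < sum q\<^sub>2 S"
      using assms(1,2) lt by (intro sum_strict_mono_ex1) (auto simp: not_less)
    then show False
      using fill[OF assms(2) lt] by simp
  qed
  then obtain y where y: "y \<in> S" "q\<^sub>2 y < q\<^sub>1 y" by blast
  then have "x \<noteq> y" using lt by auto
  then consider "beats x y" | "beats y x"
    using total assms(2) y(1) by blast
  then show False
  proof cases
    case 1
    \<comment> \<open>\<open>y\<close> is served by \<open>q\<^sub>1\<close>, so priority fills
      \<open>x\<close> there, leaving no room for the larger \<open>q\<^sub>2 x\<close>. The other
      case exchanges both the allocations and the orders.\<close>
    then have "q\<^sub>1 x = c x" using prio(1) assms(2) y by fastforce
    then show False using cap(2)[OF assms(2)] lt by simp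
  next
    case 2
    then have "q\<^sub>2 y = c y" using prio(2) assms(2) y(1) lt by fastforce
    then show False using cap(1)[OF y(1)] y(2) by simp
  qed
qed

section \<open>Matchings with a single bid\<close>

lemma Qty_pair_single_bid:
  assumes "\<And>t. t \<in> M \<Longrightarrow> id_bid t = k"
  shows "Qty_pair M i j = (if i = k then Qty_ask M j else 0)"
  using assms unfolding Qty_pair_def Qty_ask_def by (auto intro!: sum.cong sum.neutral)

text \<open>Double counting: all of \<open>M\<close> belongs to the bid id \<open>k\<close>, and
  grouping \<open>M\<close> by ask id gives the totals of the asks. Validity keeps the ask ids
  within those of \<open>A\<close>, and injectivity turns the sum over ids into a sum over
  orders.\<close>

lemma Qty_bid_single_bid:
  assumes M: "outcome M B A" and "\<And>t. t \<in> M \<Longrightarrow> id_bid t = k"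
  shows "Qty_bid M i = (if i = k then \<Sum>x\<in>A. Qty_ask M (ident x) else 0)"
proof (cases "i = k")
  case True
  have "id_ask ` M \<subseteq> ident ` A"
    using M unfolding outcome_def matching_def valid_transaction_def by auto
  then have "sum tqty M = (\<Sum>j\<in>ident ` A. Qty_ask M j)"
    unfolding Qty_ask_def using outcomeD(1-3)[OF M] by (simp add: sum.group)
  moreover have "{t \<in> M. id_bid t = i} = M"
    using assms(2) True by auto
  ultimately show ?thesis
    using True outcomeD(6,7)[OF M] unfolding Qty_bid_def by (simp add: sum.reindex)
next
  case False
  then show ?thesis
    using assms(2) unfolding Qty_bid_def by (auto intro!: sum.neutral)
qed

text \<open>The asks compete for the quantity of the one bid \<open>w\<close>. One inequality
  suffices: the hypotheses are symmetric in the two matchings, so exchanging them gives the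
  converse.\<close>

lemma single_bid_Qty_ask_le:
  assumes M1: "outcome M\<^sub>1 B A" and M2: "outcome M\<^sub>2 B A" and w: "w \<in> B"
    and single: "\<And>t. t \<in> M\<^sub>1 \<union> M\<^sub>2 \<Longrightarrow> id_bid t = ident w"
    and "x \<in> A"
  shows "Qty_ask M\<^sub>2 (ident x) \<le> Qty_ask M\<^sub>1 (ident x)"
proof (rule priority_allocation_le[where S = A and c = qty and beats = ask_beats])
  show "finite A" by (rule outcomeD[OF M1])
  show "x \<in> A" by fact
  show "ask_beats x y \<or> ask_beats y x" if "x \<in> A" "y \<in> A" "x \<noteq> y" for x y
  proof -
    have "timestamp x \<noteq> timestamp y"
      using that outcomeD(5)[OF M1] by (auto dest: inj_onD)
    then show ?thesis unfolding ask_beats_def by linarith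
  qed
  show "Qty_ask M\<^sub>1 (ident x) \<le> qty x" if "x \<in> A" for x
    using M1 that unfolding outcome_def matching_def by auto
  show "Qty_ask M\<^sub>2 (ident x) \<le> qty x" if "x \<in> A" for x
    using M2 that unfolding outcome_def matching_def by auto
  show "Qty_ask M\<^sub>1 (ident x) = qty x"
    if "x \<in> A" "y \<in> A" "ask_beats x y" "0 < Qty_ask M\<^sub>1 (ident y)" for x y
    using that M1 Qty_ask_pos_iff[OF outcomeD(1)[OF M1]] unfolding outcome_def by auto
  show "Qty_ask M\<^sub>2 (ident x) = qty x"
    if "x \<in> A" "y \<in> A" "ask_beats x y" "0 < Qty_ask M\<^sub>2 (ident y)" for x y
    using that M2 Qty_ask_pos_iff[OF outcomeD(1)[OF M2]] unfolding outcome_def by auto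
  show "(\<Sum>x\<in>A. Qty_ask M\<^sub>2 (ident x)) \<le> (\<Sum>x\<in>A. Qty_ask M\<^sub>1 (ident x))"
    if x: "x \<in> A" and lt: "Qty_ask M\<^sub>1 (ident x) < Qty_ask M\<^sub>2 (ident x)" for x
  proof -
    \<comment> \<open>A transaction of \<open>M\<^sub>2\<close> shows that \<open>w\<close> and
      \<open>x\<close> are tradable. As \<open>x\<close> is not filled in \<open>M\<^sub>1\<close>,
      \<open>w\<close> is exhausted there, and \<open>M\<^sub>2\<close> cannot use more of it; by
      double counting these uses are the two totals.\<close>
    have "ident x \<in> ids_ask M\<^sub>2"
      using lt Qty_ask_pos_iff[OF outcomeD(1)[OF M2], of "ident x"] by simp
    then obtain t where t: "t \<in> M\<^sub>2" "id_ask t = ident x"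
      unfolding ids_ask_def by auto
    then obtain b a where ba: "b \<in> B" "a \<in> A" "id_bid t = ident b" "id_ask t = ident a"
        "tradable b a"
      using M2 unfolding outcome_def matching_def valid_transaction_def by metis
    have "b = w"
      using ba single[of t] t(1) w outcomeD(6,7)[OF M1] by (auto dest: inj_onD)
    moreover have "a = x"
      using ba t(2) x outcomeD(6,7)[OF M1] by (auto dest: inj_onD)
    ultimately have "Qty_bid M\<^sub>1 (ident w) = qty w \<or> Qty_ask M\<^sub>1 (ident x) = qty x"
      using outcome_exhausted[OF M1 ba(1,2,5)] by auto
    moreover have "Qty_ask M\<^sub>2 (ident x) \<le> qty x" "Qty_bid M\<^sub>2 (ident w) \<le> qty w"
      using M2 x w unfolding outcome_def matching_def by auto
    ultimately have "Qty_bid M\<^sub>2 (ident w) \<le> Qty_bid M\<^sub>1 (ident w)"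
      using lt by auto
    then show ?thesis
      using Qty_bid_single_bid[OF M1, of "ident w" "ident w"]
        Qty_bid_single_bid[OF M2, of "ident w" "ident w"] single by simp
  qed
qed

text \<open>On \<open>A\<close> the ask totals agree by antisymmetry; other ask ids have total 0 by
  validity. With a single bid, the totals for bids and for pairs are computed from those for
  asks.\<close>

lemma single_bid_unique:
  assumes M1: "outcome M\<^sub>1 B A" and M2: "outcome M\<^sub>2 B A" and "w \<in> B"
    and single: "\<And>t. t \<in> M\<^sub>1 \<union> M\<^sub>2 \<Longrightarrow> id_bid t = ident w"
  shows "Qty_pair M\<^sub>1 = Qty_pair M\<^sub>2 \<and> Qty_bid M\<^sub>1 = Qty_bid M\<^sub>2 \<and> Qty_ask M\<^sub>1 = Qty_ask M\<^sub>2"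
proof -
  have eq: "Qty_ask M\<^sub>1 (ident x) = Qty_ask M\<^sub>2 (ident x)" if "x \<in> A" for x
    using single_bid_Qty_ask_le[OF M1 M2 assms(3) _ that]
      single_bid_Qty_ask_le[OF M2 M1 assms(3) _ that] single by (intro antisym) auto
  have zero: "Qty_ask M j = 0" if "outcome M B A" "j \<notin> ident ` A" for M j
    using that unfolding outcome_def matching_def valid_transaction_def Qty_ask_def
    by (intro sum.neutral) auto
  have "Qty_ask M\<^sub>1 j = Qty_ask M\<^sub>2 j" for j
    by (cases "j \<in> ident ` A") (auto simp: eq zero[OF M1] zero[OF M2])
  then have "Qty_ask M\<^sub>1 = Qty_ask M\<^sub>2" by blast
  moreover have "Qty_bid M\<^sub>1 i = Qty_bid M\<^sub>2 i" for i
    using Qty_bid_single_bid[OF M1, of "ident w" i] Qty_bid_single_bid[OF M2, of "ident w" i]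
      single eq by simp
  moreover have "Qty_pair M\<^sub>1 i j = Qty_pair M\<^sub>2 i j" for i j
    using Qty_pair_single_bid[of M\<^sub>1 "ident w" i j] Qty_pair_single_bid[of M\<^sub>2 "ident w" i j]
      single \<open>Qty_ask M\<^sub>1 = Qty_ask M\<^sub>2\<close> by simp
  ultimately show ?thesis by blast
qed

section \<open>Matchings with a single ask\<close>

lemma Qty_pair_single_ask:
  assumes "\<And>t. t \<in> M \<Longrightarrow> id_ask t = k"
  shows "Qty_pair M i j = (if j = k then Qty_bid M i else 0)"
  using assms unfolding Qty_pair_def Qty_bid_def by (auto intro!: sum.cong sum.neutral)

lemma Qty_ask_single_ask:
  assumes M: "outcome M B A" and "\<And>t. t \<in> M \<Longrightarrow> id_ask t = k"
  shows "Qty_ask M i = (if i = k then \<Sum>x\<in>B. Qty_bid M (ident x) else 0)"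
proof (cases "i = k")
  case True
  have "id_bid ` M \<subseteq> ident ` B"
    using M unfolding outcome_def matching_def valid_transaction_def by auto
  then have "sum tqty M = (\<Sum>j\<in>ident ` B. Qty_bid M j)"
    unfolding Qty_bid_def using outcomeD(1-3)[OF M] by (simp add: sum.group)
  moreover have "{t \<in> M. id_ask t = i} = M"
    using assms(2) True by auto
  ultimately show ?thesis
    using True outcomeD(6,7)[OF M] unfolding Qty_ask_def by (simp add: sum.reindex)
next
  case False
  then show ?thesis
    using assms(2) unfolding Qty_ask_def by (auto intro!: sum.neutral)
qed

text \<open>Mirror image: the bids now compete for the one ask \<open>w\<close>, ranked by
  \<open>bid_beats\<close>.\<close>

lemma single_ask_Qty_bid_le:
  assumes M1: "outcome M\<^sub>1 B A" and M2: "outcome M\<^sub>2 B A" and w: "w \<in> A"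
    and single: "\<And>t. t \<in> M\<^sub>1 \<union> M\<^sub>2 \<Longrightarrow> id_ask t = ident w"
    and "x \<in> B"
  shows "Qty_bid M\<^sub>2 (ident x) \<le> Qty_bid M\<^sub>1 (ident x)"
proof (rule priority_allocation_le[where S = B and c = qty and beats = bid_beats])
  show "finite B" by (rule outcomeD[OF M1])
  show "x \<in> B" by fact
  show "bid_beats x y \<or> bid_beats y x" if "x \<in> B" "y \<in> B" "x \<noteq> y" for x y
  proof -
    have "timestamp x \<noteq> timestamp y"
      using that outcomeD(5)[OF M1] by (auto dest: inj_onD)
    then show ?thesis unfolding bid_beats_def by linarith
  qed
  show "Qty_bid M\<^sub>1 (ident x) \<le> qty x" if "x \<in> B" for x
    using M1 that unfolding outcome_def matching_def by auto
  show "Qty_bid M\<^sub>2 (ident x) \<le> qty x" if "x \<in> B" for x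
    using M2 that unfolding outcome_def matching_def by auto
  show "Qty_bid M\<^sub>1 (ident x) = qty x"
    if "x \<in> B" "y \<in> B" "bid_beats x y" "0 < Qty_bid M\<^sub>1 (ident y)" for x y
    using that M1 Qty_bid_pos_iff[OF outcomeD(1)[OF M1]] unfolding outcome_def by auto
  show "Qty_bid M\<^sub>2 (ident x) = qty x"
    if "x \<in> B" "y \<in> B" "bid_beats x y" "0 < Qty_bid M\<^sub>2 (ident y)" for x y
    using that M2 Qty_bid_pos_iff[OF outcomeD(1)[OF M2]] unfolding outcome_def by auto
  show "(\<Sum>x\<in>B. Qty_bid M\<^sub>2 (ident x)) \<le> (\<Sum>x\<in>B. Qty_bid M\<^sub>1 (ident x))"
    if x: "x \<in> B" and lt: "Qty_bid M\<^sub>1 (ident x) < Qty_bid M\<^sub>2 (ident x)" for x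
  proof -
    have "ident x \<in> ids_bid M\<^sub>2"
      using lt Qty_bid_pos_iff[OF outcomeD(1)[OF M2], of "ident x"] by simp
    then obtain t where t: "t \<in> M\<^sub>2" "id_bid t = ident x"
      unfolding ids_bid_def by auto
    then obtain b a where ba: "b \<in> B" "a \<in> A" "id_bid t = ident b" "id_ask t = ident a"
        "tradable b a"
      using M2 unfolding outcome_def matching_def valid_transaction_def by metis
    have "a = w"
      using ba single[of t] t(1) w outcomeD(6,7)[OF M1] by (auto dest: inj_onD)
    moreover have "b = x"
      using ba t(2) x outcomeD(6,7)[OF M1] by (auto dest: inj_onD)
    ultimately have "Qty_ask M\<^sub>1 (ident w) = qty w \<or> Qty_bid M\<^sub>1 (ident x) = qty x"
      using outcome_exhausted[OF M1 ba(1,2,5)] by auto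
    moreover have "Qty_bid M\<^sub>2 (ident x) \<le> qty x" "Qty_ask M\<^sub>2 (ident w) \<le> qty w"
      using M2 x w unfolding outcome_def matching_def by auto
    ultimately have "Qty_ask M\<^sub>2 (ident w) \<le> Qty_ask M\<^sub>1 (ident w)"
      using lt by auto
    then show ?thesis
      using Qty_ask_single_ask[OF M1, of "ident w" "ident w"]
        Qty_ask_single_ask[OF M2, of "ident w" "ident w"] single by simp
  qed
qed

lemma single_ask_unique:
  assumes M1: "outcome M\<^sub>1 B A" and M2: "outcome M\<^sub>2 B A" and "w \<in> A"
    and single: "\<And>t. t \<in> M\<^sub>1 \<union> M\<^sub>2 \<Longrightarrow> id_ask t = ident w"
  shows "Qty_pair M\<^sub>1 = Qty_pair M\<^sub>2 \<and> Qty_bid M\<^sub>1 = Qty_bid M\<^sub>2 \<and> Qty_ask M\<^sub>1 = Qty_ask M\<^sub>2"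
proof -
  have eq: "Qty_bid M\<^sub>1 (ident x) = Qty_bid M\<^sub>2 (ident x)" if "x \<in> B" for x
    using single_ask_Qty_bid_le[OF M1 M2 assms(3) _ that]
      single_ask_Qty_bid_le[OF M2 M1 assms(3) _ that] single by (intro antisym) auto
  have zero: "Qty_bid M j = 0" if "outcome M B A" "j \<notin> ident ` B" for M j
    using that unfolding outcome_def matching_def valid_transaction_def Qty_bid_def
    by (intro sum.neutral) auto
  have "Qty_bid M\<^sub>1 j = Qty_bid M\<^sub>2 j" for j
    by (cases "j \<in> ident ` B") (auto simp: eq zero[OF M1] zero[OF M2])
  then have "Qty_bid M\<^sub>1 = Qty_bid M\<^sub>2" by blast
  moreover have "Qty_ask M\<^sub>1 i = Qty_ask M\<^sub>2 i" for i
    using Qty_ask_single_ask[OF M1, of "ident w" i] Qty_ask_single_ask[OF M2, of "ident w" i]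
      single eq by simp
  moreover have "Qty_pair M\<^sub>1 i j = Qty_pair M\<^sub>2 i j" for i j
    using Qty_pair_single_ask[of M\<^sub>1 "ident w" i j] Qty_pair_single_ask[of M\<^sub>2 "ident w" i j]
      single \<open>Qty_bid M\<^sub>1 = Qty_bid M\<^sub>2\<close> by simp
  ultimately show ?thesis by blast
qed

section \<open>Uniqueness for a single instruction\<close>

text \<open>Stated for totals since the matchings themselves may differ: the same pair total can be
  split into different transactions.\<close>

lemma outcome_unique:
  assumes "\<not> matchable B A" "absorb B A (\<Delta>, \<omega>) = (B', A')"
    and M1: "outcome M\<^sub>1 B' A'" and M2: "outcome M\<^sub>2 B' A'"
  shows "Qty_pair M\<^sub>1 = Qty_pair M\<^sub>2 \<and> Qty_bid M\<^sub>1 = Qty_bid M\<^sub>2 \<and> Qty_ask M\<^sub>1 = Qty_ask M\<^sub>2"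
proof -
  have valid: "valid_transaction t B' A'" if "t \<in> M\<^sub>1 \<union> M\<^sub>2" for t
    using that M1 M2 unfolding outcome_def matching_def by auto
  show ?thesis
  proof (cases \<Delta>)
    case Buy
    \<comment> \<open>\<open>B'\<close> exceeds \<open>B\<close> at most by \<omega> and
      \<open>A' = A\<close>, so a transaction with a bid of \<open>B\<close> would make
      \<open>(B, A)\<close> matchable.\<close>
    have "id_bid t = ident \<omega>" if "t \<in> M\<^sub>1 \<union> M\<^sub>2" for t
      using valid[OF that] assms(1,2) Buy unfolding valid_transaction_def matchable_def by auto
    then show ?thesis
      using assms(2) Buy by (intro single_bid_unique[OF M1 M2, of \<omega>]) auto
  next
    case Sell
    have "id_ask t = ident \<omega>" if "t \<in> M\<^sub>1 \<union> M\<^sub>2" for t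
      using valid[OF that] assms(1,2) Sell unfolding valid_transaction_def matchable_def by auto
    then show ?thesis
      using assms(2) Sell by (intro single_ask_unique[OF M1 M2, of \<omega>]) auto
  next
    case Del
    \<comment> \<open>Deletion only shrinks both sides, so no pair is tradable and both matchings
      are empty.\<close>
    have "t \<notin> M\<^sub>1 \<union> M\<^sub>2" for t
      using valid[of t] assms(1,2) Del unfolding valid_transaction_def matchable_def by auto
    then have "M\<^sub>1 = M\<^sub>2" by blast
    then show ?thesis by simp
  qed
qed

text \<open>Admissibility does not exclude an order occurring both as a bid and as an ask. Since such an
  order is tradable with itself, it cannot remain on both sides of the residual order-domain.\<close>

lemma residual_idents_timestamps:
  assumes "outcome M B A"
  defines "R \<equiv> order_diff B (Bids M B) \<union> order_diff A (Asks M A)"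
  shows "inj_on ident R" "inj_on timestamp R" "ident ` R \<subseteq> ident ` (B \<union> A)"
    "timestamp ` R \<subseteq> timestamp ` (B \<union> A)"
proof -
  have origin: "\<exists>z\<in>B \<union> A. ident x = ident z \<and> timestamp x = timestamp z" if "x \<in> R" for x
    using that unfolding R_def order_diff_Bids[OF assms(1)] order_diff_Asks[OF assms(1)]
    by (auto elim!: requantifyE)
  then show "ident ` R \<subseteq> ident ` (B \<union> A)" "timestamp ` R \<subseteq> timestamp ` (B \<union> A)"
    by blast+
  have apart: "ident b \<noteq> ident a"
    if ba: "b \<in> order_diff B (Bids M B)" "a \<in> order_diff A (Asks M A)" for b a
  proof
    assume "ident b = ident a"
    obtain b' where b': "b' \<in> B" "ident b = ident b'" "price b = price b'"
      using ba(1) unfolding order_diff_Bids[OF assms(1)] by (auto elim!: requantifyE)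
    obtain a' where a': "a' \<in> A" "ident a = ident a'" "price a = price a'"
      using ba(2) unfolding order_diff_Asks[OF assms(1)] by (auto elim!: requantifyE)
    have "b' = a'"
      using b' a' \<open>ident b = ident a\<close> outcomeD(4)[OF assms(1)] by (auto dest: inj_onD)
    then have "tradable b a"
      using b' a' unfolding tradable_def by simp
    then show False
      using assms(1) ba unfolding outcome_def matchable_def by blast
  qed
  have "inj_on ident (order_diff B (Bids M B))" "inj_on ident (order_diff A (Asks M A))"
    unfolding order_diff_Bids[OF assms(1)] order_diff_Asks[OF assms(1)]
    using outcomeD(6,7)[OF assms(1)] by (auto intro: inj_on_ident_requantify)
  then show ident: "inj_on ident R"
    using apart unfolding R_def inj_on_Un by fastforce
  show "inj_on timestamp R"
  proof (rule inj_onI)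
    fix x y assume "x \<in> R" "y \<in> R" "timestamp x = timestamp y"
    \<comment> \<open>Equal timestamps force the same origin, which reduces the claim to the
      injectivity of \<open>ident\<close>.\<close>
    then have "ident x = ident y"
      using origin[of x] origin[of y] outcomeD(5)[OF assms(1)] by (metis inj_onD)
    then show "x = y"
      using ident \<open>x \<in> R\<close> \<open>y \<in> R\<close> by (auto dest: inj_onD)
  qed
qed

section \<open>Application to processes\<close>

text \<open>Specialises the process properties to one legal input; conservation writes the residual
  sets through \<open>M\<close>, so that the spread becomes a condition on \<open>M\<close>.\<close>

lemma process_outcome:
  assumes "price_time_priority P" "positive_bid_ask_spread P" "conservation P"
    and "legal_input B A \<tau>" "P B A \<tau> = (Bh, Ah, M)" "absorb B A \<tau> = (B', A')"
  shows "outcome M B' A' \<and> Bh = order_diff B' (Bids M B') \<and> Ah = order_diff A' (Asks M A')"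
proof -
  have "matching M B' A' \<and> Bh = order_diff B' (Bids M B') \<and> Ah = order_diff A' (Asks M A')"
    using assms(3-6) unfolding conservation_def by blast
  moreover have "\<not> matchable Bh Ah"
    using assms(2,4,5) unfolding positive_bid_ask_spread_def by blast
  moreover have
    "\<forall>a\<in>A'. \<forall>a'\<in>A'. ask_beats a a' \<and> ident a' \<in> ids_ask M \<longrightarrow> Qty_ask M (ident a) = qty a"
    using assms(1)[unfolded price_time_priority_def, rule_format, OF assms(4-6)] by blast
  moreover have
    "\<forall>b\<in>B'. \<forall>b'\<in>B'. bid_beats b b' \<and> ident b' \<in> ids_bid M \<longrightarrow> Qty_bid M (ident b) = qty b"
    using assms(1)[unfolded price_time_priority_def, rule_format, OF assms(4-6)] by blast
  ultimately show ?thesis unfolding outcome_def by blast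
qed

theorem theorem1:
  fixes P1 P2 :: process
    and B A B1 A1 B2 A2 :: "auction_order set"
    and M1 M2 :: "transaction set"
    and \<Delta> :: command and \<omega> :: auction_order
  assumes "price_time_priority P1" "positive_bid_ask_spread P1" "conservation P1"
    and "price_time_priority P2" "positive_bid_ask_spread P2" "conservation P2"
    and "order_domain B A"
    and "legal_input B A (\<Delta>, \<omega>)"
    and "P1 B A (\<Delta>, \<omega>) = (B1, A1, M1)"
    and "P2 B A (\<Delta>, \<omega>) = (B2, A2, M2)"
  shows "(B1, A1, canonical M1) = (B2, A2, canonical M2) \<and>
    (\<forall>(Bh, Ah) \<in> {(B1, A1), (B2, A2)}.
       \<not> matchable Bh Ah \<and>
       (inj_on timestamp (Bh \<union> Ah) \<and>
        timestamp ` (Bh \<union> Ah) \<subseteq> timestamp ` (B \<union> A \<union> {\<omega>})) \<and>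
       (inj_on ident (Bh \<union> Ah) \<and>
        ids (Bh \<union> Ah) \<subseteq> ids (B \<union> A) \<union> {ident \<omega>}) \<and>
       (\<Delta> = Del \<longrightarrow> ident \<omega> \<notin> ids (Bh \<union> Ah)))"
proof -
  obtain B' A' where absorb: "absorb B A (\<Delta>, \<omega>) = (B', A')"
    by fastforce
  have 1: "outcome M1 B' A'" "B1 = order_diff B' (Bids M1 B')" "A1 = order_diff A' (Asks M1 A')"
    using process_outcome[OF assms(1-3,8,9) absorb] by auto
  have 2: "outcome M2 B' A'" "B2 = order_diff B' (Bids M2 B')" "A2 = order_diff A' (Asks M2 A')"
    using process_outcome[OF assms(4-6,8,10) absorb] by auto
  have "\<not> matchable B A"
    using assms(8) unfolding legal_input_def by blast
  \<comment> \<open>\<open>canonical\<close>, \<open>Bids\<close> and \<open>Asks\<close> depend on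
    a matching only through these three totals, so their equality fixes the whole result.\<close>
  from outcome_unique[OF this absorb 1(1) 2(1)]
  have "B1 = B2" "A1 = A2" "canonical M1 = canonical M2"
    unfolding 1 2 Bids_eq_requantify Asks_eq_requantify canonical_def by simp_all
  have sub: "B' \<union> A' \<subseteq> B \<union> A \<union> {\<omega>}" "\<Delta> = Del \<Longrightarrow> ident \<omega> \<notin> ident ` (B' \<union> A')"
    using absorb by (cases \<Delta>; auto)+
  \<comment> \<open>Since the two residual order-domains coincide, the remaining claims are checked
    for the first only.\<close>
  have "\<not> matchable B1 A1"
    using 1 unfolding outcome_def by simp
  moreover have "timestamp ` (B1 \<union> A1) \<subseteq> timestamp ` (B \<union> A \<union> {\<omega>})"
    using residual_idents_timestamps(4)[OF 1(1)] sub(1) unfolding 1(2,3)[symmetric] by blast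
  moreover have "ids (B1 \<union> A1) \<subseteq> ids (B \<union> A) \<union> {ident \<omega>}"
    using residual_idents_timestamps(3)[OF 1(1)] sub(1) unfolding 1(2,3)[symmetric] ids_def by blast
  moreover have "\<Delta> = Del \<longrightarrow> ident \<omega> \<notin> ids (B1 \<union> A1)"
    using residual_idents_timestamps(3)[OF 1(1)] sub(2) unfolding 1(2,3)[symmetric] ids_def by blast
  moreover have "inj_on ident (B1 \<union> A1)" "inj_on timestamp (B1 \<union> A1)"
    using residual_idents_timestamps(1,2)[OF 1(1)] unfolding 1(2,3)[symmetric] by auto
  ultimately show ?thesis
    using \<open>B1 = B2\<close> \<open>A1 = A2\<close> \<open>canonical M1 = canonical M2\<close> by simp
qed

end
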